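(* For every $V\in\mathcal F$, the iterates $\mathcal R^n(V)$ converge to $V^*$: for every integer $k\ge1$ and every $x\in M_k$, $$\lim_{n\to\infty}\mathcal R^n(V)(x)=V^*(x)=\log\frac{k+1}{k}.$$ The potential $V^*$ is a fixed point of $\mathcal R$, in the sense that $\mathcal R(V^* )(x)=V^*(x)$ for every $x\in M_k$, $k\ge1$.
   Context: $\Sigma=\{0,1\}^{\mathbb N}$ with the product topology. For $k\ge1$, $M_k\subset\Sigma$ is the cylinder set of sequences beginning with exactly $k$ zeros followed by a $1$. The set $\mathcal F$ consists of the non-negative continuous functions $V:\Sigma\to\mathbb R$ which are constant on $M_n$ for each $n\ge1$, with value denoted $a_n$, and such that $a_n=\frac1n+O\big(\frac1{n^{1+\varepsilon}}\big)$ as $n\to\infty$ for some $\varepsilon>0$. The renormalization operator $\mathcal R$ is defined as follows: for $x=(\underbrace{0,\ldots,0}_{c_1},w)$ with $c_1\ge 1$ and $w\in\Sigma$ beginning with $1$, $$\mathcal R(V)(x)=V(\underbrace{0,\ldots,0}_{2c_1},w)+V(\underbrace{0,\ldots,0}_{2c_1+1},w).$$ The iterates $\mathcal R^n(V)$ are considered on $\bigcup_{k\ge1}M_k$. The potential $V^*$ is defined on $\bigcup_{k\ge1}M_k$ by $V^*(x)=\log\frac{k+1}{k}$ for $x\in M_k$. *)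

theory Defs
  imports "HOL-Analysis.Analysis" "HOL-Library.Landau_Symbols"
begin

text \<open>The alphabet \<open>{0,1}\<close> is \<^typ>\<open>bool\<close> (0 is \<^const>\<open>False\<close>, 1 is \<^const>\<open>True\<close>) with its discrete
  topology; the library topology on \<^typ>\<open>nat \<Rightarrow> bool\<close> is then the product topology on \<open>\<Sigma>\<close>.\<close>

type_synonym seq01 = "nat \<Rightarrow> bool"

text \<open>The concatenation of \<open>c\<close> zeros and \<open>w\<close>.\<close>

definition prepend_zeros :: "nat \<Rightarrow> seq01 \<Rightarrow> seq01" where
  "prepend_zeros c w = (\<lambda>i. if i < c then False else w (i - c))"

definition M :: "nat \<Rightarrow> seq01 set" where
  "M k = {x. (\<forall>i<k. \<not> x i) \<and> x k}"

definition \<F> :: "(seq01 \<Rightarrow> real) set" where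
  "\<F> = {V. continuous_on UNIV V \<and> (\<forall>x. V x \<ge> 0) \<and>
     (\<exists>a :: nat \<Rightarrow> real. (\<forall>n\<ge>1. \<forall>x\<in>M n. V x = a n) \<and>
        (\<exists>\<epsilon>>0. (\<lambda>n. a n - 1 / real n) \<in> O(\<lambda>n. 1 / real n powr (1 + \<epsilon>))))}"

text \<open>The number of zeros before the first 1; meaningful only if \<open>x\<close> contains a 1.\<close>

definition lead_zeros :: "seq01 \<Rightarrow> nat" where
  "lead_zeros x = (LEAST i. x i)"

text \<open>Both \<open>\<R> V\<close> and \<open>V\<^sup>*\<close> live on \<open>\<Union>k\<ge>1. M k\<close> only; they are \<^const>\<open>undefined\<close> elsewhere.
  The points at which \<open>\<R> V\<close> evaluates \<open>V\<close> lie in \<open>\<Union>k\<ge>1. M k\<close> again, so iterating is unproblematic.\<close>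

definition \<R> :: "(seq01 \<Rightarrow> real) \<Rightarrow> seq01 \<Rightarrow> real" where
  "\<R> V = (\<lambda>x \<in> (\<Union>k\<in>{1..}. M k).
     let c = lead_zeros x; w = (\<lambda>i. x (c + i))
     in V (prepend_zeros (2 * c) w) + V (prepend_zeros (2 * c + 1) w))"

definition Vstar :: "seq01 \<Rightarrow> real" where
  "Vstar = (\<lambda>x \<in> (\<Union>k\<in>{1..}. M k).
     ln ((real (lead_zeros x) + 1) / real (lead_zeros x)))"

lemma lead_zeros_M: "x \<in> M k \<Longrightarrow> lead_zeros x = k"
  unfolding lead_zeros_def M_def by (auto intro!: Least_equality simp: not_less[symmetric])

lemma prepend_zeros_in_M: "w 0 \<Longrightarrow> prepend_zeros c w \<in> M c"
  by (simp add: M_def prepend_zeros_def)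

lemma \<R>_prepend_zeros:
  assumes "c \<ge> 1" and "w 0"
  shows "\<R> V (prepend_zeros c w)
    = V (prepend_zeros (2 * c) w) + V (prepend_zeros (2 * c + 1) w)"
proof -
  have "prepend_zeros c w \<in> M c"
    using assms(2) by (rule prepend_zeros_in_M)
  moreover from this have "lead_zeros (prepend_zeros c w) = c"
    by (rule lead_zeros_M)
  moreover have "(\<lambda>i. prepend_zeros c w (c + i)) = w"
    by (simp add: prepend_zeros_def)
  ultimately show ?thesis
    using assms(1) by (auto simp: \<R>_def)
qed

end

theory Submission
  imports Defs "HOL-Real_Asymp.Real_Asymp"
begin

text \<open>
  On \<open>M k\<close> the operator \<open>\<R>\<close> turns the value \<open>a k\<close> into \<open>a (2 * k) + a (2 * k + 1)\<close>, so \<open>n\<close> iterations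
  turn it into the sum of \<open>a\<close> over the dyadic block \<open>{2 ^ n * k..<2 ^ n * (k + 1)}\<close> (lemma
  \<open>funpow_renorm_on_M\<close>).  For \<open>V\<^sup>*\<close> the summands are \<open>ln (j + 1) - ln j\<close>, so every block sum telescopes
  to \<open>ln ((k + 1) / k)\<close>; this is why \<open>V\<^sup>*\<close> is a fixed point.

  For \<open>V \<in> \<F>\<close> it remains to see that the block sums of the difference \<open>d j = a j - ln ((j + 1) / j)\<close> tend
  to zero.  The block has \<open>2 ^ n\<close> terms, all with index at least \<open>2 ^ n * k\<close>, so it suffices that
  \<open>d j = o(1 / j)\<close> (lemma \<open>block_sum_tendsto_0\<close>), and both \<open>a j\<close> and \<open>ln ((j + 1) / j)\<close> are
  \<open>1 / j + o(1 / j)\<close>.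
\<close>

lemma renorm_on_M:
  assumes V: "\<And>k x. k \<ge> 1 \<Longrightarrow> x \<in> M k \<Longrightarrow> V x = a k"
    and k: "k \<ge> 1" and x: "x \<in> M k"
  shows "\<R> V x = a (2 * k) + a (2 * k + 1)"
proof -
  define w where "w = (\<lambda>i. x (k + i))"
  have w: "w 0" and "x = prepend_zeros k w"
    using x by (auto simp: w_def M_def prepend_zeros_def)
  then have "\<R> V x = V (prepend_zeros (2 * k) w) + V (prepend_zeros (2 * k + 1) w)"
    using k by (simp add: \<R>_prepend_zeros)
  moreover have "V (prepend_zeros c w) = a c" if "c \<ge> 1" for c
    by (rule V[OF that]) (rule prepend_zeros_in_M[of w c, OF w])
  ultimately show ?thesis
    using k by simp
qed

text \<open>Doubling \<open>k\<close> splits the block of level \<open>n + 1\<close> over \<open>k\<close> into the two adjacent blocks of level \<open>n\<close>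
  over \<open>2 * k\<close> and \<open>2 * k + 1\<close>.\<close>

lemma funpow_renorm_on_M:
  assumes V: "\<And>k x. k \<ge> 1 \<Longrightarrow> x \<in> M k \<Longrightarrow> V x = a k"
    and "k \<ge> 1" and "x \<in> M k"
  shows "(\<R> ^^ n) V x = (\<Sum>j = 2 ^ n * k..<2 ^ n * (k + 1). a j)"
  using assms(2,3)
proof (induction n arbitrary: k x)
  case 0
  then show ?case by (simp add: V)
next
  case (Suc n)
  define b where "b k = (\<Sum>j = 2 ^ n * k..<2 ^ n * (k + 1). a j)" for k
  have "(\<R> ^^ Suc n) V x = b (2 * k) + b (2 * k + 1)"
    using renorm_on_M[of "(\<R> ^^ n) V" b] Suc by (simp add: b_def)
  also have "\<dots> = (\<Sum>j = 2 ^ n * (2 * k)..<2 ^ n * (2 * k + 1 + 1). a j)"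
    unfolding b_def by (rule sum.atLeastLessThan_concat) auto
  also have "\<dots> = (\<Sum>j = 2 ^ Suc n * k..<2 ^ Suc n * (k + 1). a j)"
    by (simp add: algebra_simps)
  finally show ?case .
qed

lemma block_sum_ln:
  fixes m k :: nat
  assumes "m \<ge> 1" and "k \<ge> 1"
  shows "(\<Sum>j = m * k..<m * (k + 1). ln ((real j + 1) / real j)) = ln ((real k + 1) / real k)"
proof -
  have "m * k \<ge> 1"
    using assms by simp
  then have "(\<Sum>j = m * k..<m * (k + 1). ln ((real j + 1) / real j))
      = (\<Sum>j = m * k..<m * (k + 1). ln (real (Suc j)) - ln (real j))"
    by (intro sum.cong) (auto simp: ln_div add.commute)
  also have "\<dots> = ln (real (m * (k + 1))) - ln (real (m * k))"
    by (rule sum_Suc_diff') simp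
  also have "\<dots> = ln (real (m * (k + 1)) / real (m * k))"
    using assms by (intro ln_divide_pos[symmetric]) (simp_all only: of_nat_0_less_iff, simp_all)
  also have "\<dots> = ln ((real k + 1) / real k)"
    using assms by (subst (1 2) of_nat_mult) (simp add: add.commute)
  finally show ?thesis .
qed

text \<open>If \<open>\<bar>j * d j\<bar> < e\<close> for all \<open>j\<close> in a block \<open>{m * k..<m * (k + 1)}\<close> with \<open>k \<ge> 1\<close>, then each of its \<open>m\<close>
  terms is at most \<open>e / m\<close> in absolute value, so the block sum is at most \<open>e\<close>, uniformly in \<open>m\<close>.\<close>

lemma block_sum_tendsto_0:
  fixes d :: "nat \<Rightarrow> real"
  assumes d: "(\<lambda>j. real j * d j) \<longlonglongrightarrow> 0" and k: "k \<ge> 1"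
  shows "(\<lambda>m. \<Sum>j = m * k..<m * (k + 1). d j) \<longlonglongrightarrow> 0"
proof (rule LIMSEQ_I)
  fix r :: real
  assume r: "r > 0"
  then obtain N where N: "\<And>j. j \<ge> N \<Longrightarrow> \<bar>real j * d j\<bar> < r / 2"
    using LIMSEQ_D[OF d, of "r / 2"] by auto
  have "\<bar>\<Sum>j = m * k..<m * (k + 1). d j\<bar> < r" if m: "m \<ge> max N 1" for m
  proof -
    have "\<bar>d j\<bar> \<le> r / 2 / real m" if "j \<in> {m * k..<m * (k + 1)}" for j
    proof -
      have "m * 1 \<le> m * k"
        using k by (intro mult_le_mono) auto
      then have j: "j \<ge> m"
        using that by (simp only: atLeastLessThan_iff) linarith
      then have "real m * \<bar>d j\<bar> \<le> real j * \<bar>d j\<bar>"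
        by (intro mult_right_mono) auto
      also have "\<dots> \<le> r / 2"
        using N[of j] m j by (simp add: abs_mult)
      finally show ?thesis
        using m by (simp add: field_simps)
    qed
    then have "(\<Sum>j = m * k..<m * (k + 1). \<bar>d j\<bar>)
        \<le> (\<Sum>j = m * k..<m * (k + 1). r / 2 / real m)"
      by (rule sum_mono)
    also have "\<dots> = r / 2"
      using m by simp
    finally show ?thesis
      using sum_abs[of d "{m * k..<m * (k + 1)}"] r by linarith
  qed
  then show "\<exists>m0. \<forall>m\<ge>m0. norm ((\<Sum>j = m * k..<m * (k + 1). d j) - 0) < r"
    by (intro exI[of _ "max N 1"]) simp
qed

lemma diff_ln_little_o:
  fixes a :: "nat \<Rightarrow> real"
  assumes "\<epsilon> > 0" and a: "(\<lambda>n. a n - 1 / real n) \<in> O(\<lambda>n. 1 / real n powr (1 + \<epsilon>))"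
  shows "(\<lambda>n. real n * (a n - ln ((real n + 1) / real n))) \<longlonglongrightarrow> 0"
proof -
  have "(\<lambda>n. 1 / real n powr (1 + \<epsilon>)) \<in> o(\<lambda>n. 1 / real n)"
    using \<open>\<epsilon> > 0\<close> by real_asymp
  with a have "(\<lambda>n. a n - 1 / real n) \<in> o(\<lambda>n. 1 / real n)"
    by (rule landau_o.big_small_trans)
  moreover have "(\<lambda>n. 1 / real n - ln ((real n + 1) / real n)) \<in> o(\<lambda>n. 1 / real n)"
    by real_asymp
  ultimately have "(\<lambda>n. (a n - 1 / real n) + (1 / real n - ln ((real n + 1) / real n)))
      \<in> o(\<lambda>n. 1 / real n)"
    by (rule sum_in_smallo)
  then have "(\<lambda>n. (a n - ln ((real n + 1) / real n)) / (1 / real n)) \<longlonglongrightarrow> 0"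
    by (intro smalloD_tendsto) simp
  then show ?thesis
    by (simp add: mult.commute)
qed

lemma Vstar_on_M: "k \<ge> 1 \<Longrightarrow> x \<in> M k \<Longrightarrow> Vstar x = ln ((real k + 1) / real k)"
  by (auto simp: Vstar_def lead_zeros_M)

lemma renorm_Vstar:
  assumes "k \<ge> 1" and "x \<in> M k"
  shows "\<R> Vstar x = Vstar x"
proof -
  have "(\<R> ^^ 1) Vstar x = (\<Sum>j = 2 ^ 1 * k..<2 ^ 1 * (k + 1). ln ((real j + 1) / real j))"
    using Vstar_on_M assms by (rule funpow_renorm_on_M)
  then show ?thesis
    using block_sum_ln[of "2 ^ 1" k] assms by (simp add: Vstar_on_M)
qed

lemma funpow_renorm_tendsto_Vstar:
  assumes "V \<in> \<F>" and k: "k \<ge> 1" and x: "x \<in> M k"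
  shows "(\<lambda>n. (\<R> ^^ n) V x) \<longlonglongrightarrow> Vstar x"
proof -
  obtain a \<epsilon> where V: "\<And>k x. k \<ge> 1 \<Longrightarrow> x \<in> M k \<Longrightarrow> V x = a k" and "\<epsilon> > 0"
    and a: "(\<lambda>n. a n - 1 / real n) \<in> O(\<lambda>n. 1 / real n powr (1 + \<epsilon>))"
    using \<open>V \<in> \<F>\<close> by (auto simp: \<F>_def)
  define d where "d j = a j - ln ((real j + 1) / real j)" for j
  have "(\<R> ^^ n) V x = Vstar x + (\<Sum>j = 2 ^ n * k..<2 ^ n * (k + 1). d j)" for n
    using block_sum_ln[of "2 ^ n" k] funpow_renorm_on_M[of V a, OF V k x] k x
    by (simp add: Vstar_on_M d_def sum_subtractf)
  moreover have "(\<lambda>n. \<Sum>j = 2 ^ n * k..<2 ^ n * (k + 1). d j) \<longlonglongrightarrow> 0"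
  proof (rule filterlim_compose[OF block_sum_tendsto_0])
    show "(\<lambda>j. real j * d j) \<longlonglongrightarrow> 0"
      unfolding d_def using \<open>\<epsilon> > 0\<close> a by (rule diff_ln_little_o)
    show "filterlim (\<lambda>n. 2 ^ n :: nat) at_top sequentially"
      by (rule filterlim_subseq) (simp add: strict_mono_def)
  qed (rule k)
  ultimately show ?thesis
    using tendsto_add[OF tendsto_const, of _ 0 sequentially "Vstar x"] by simp
qed

theorem theorem2p2:
  shows "(\<forall>V\<in>\<F>. \<forall>k\<ge>1. \<forall>x\<in>M k.
            (\<lambda>n. (\<R> ^^ n) V x) \<longlonglongrightarrow> Vstar x \<and> Vstar x = ln ((real k + 1) / real k))
       \<and> (\<forall>k\<ge>1. \<forall>x\<in>M k. \<R> Vstar x = Vstar x)"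
  using funpow_renorm_tendsto_Vstar Vstar_on_M renorm_Vstar by blast

end
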